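(* For every centered log-concave probability measure $\mu$ on $\mathbb{R}^n$, $$\int_{\mathbb{R}^n}\exp\left(\frac{\Lambda_\mu^{\ast}(x)}{16n}\right)\,d\mu(x)\le 2\exp\left(\frac{n\ln n}{16}\right).$$
   Context: A Borel probability measure $\mu$ on $\mathbb{R}^n$ is called log-concave if $\mu(H)<1$ for every hyperplane $H$ of $\mathbb{R}^n$ and $\mu(\lambda A+(1-\lambda)B)\ge \mu(A)^{\lambda}\mu(B)^{1-\lambda}$ for all compact sets $A,B\subset\mathbb{R}^n$ and all $\lambda\in(0,1)$. It is centered if its barycenter is the origin. The log-Laplace transform is $\Lambda_\mu(\xi)=\ln\left(\int_{\mathbb{R}^n}e^{\langle\xi,z\rangle}\,d\mu(z)\right)$ and the Cramér transform of $\mu$ is its Legendre transform $\Lambda_\mu^\ast(x)=\sup_{\xi\in\mathbb{R}^n}\{\langle x,\xi\rangle-\Lambda_\mu(\xi)\}$. *)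

theory Defs
  imports "HOL-Probability.Probability"
begin

text \<open>
  The log-Laplace transform may take the value \<open>\<infinity>\<close>, and so may its Legendre transform
  (e.g. outside the convex hull of the support). Both are therefore \<^typ>\<open>ereal\<close>-valued,
  and \<open>ln\<close> and \<open>exp\<close> are extended by their limits at the ends of their domains.
\<close>

definition ext_ln :: "ennreal \<Rightarrow> ereal" where
  "ext_ln t = (if t = 0 then - \<infinity> else if t = \<infinity> then \<infinity> else ereal (ln (enn2real t)))"

definition ext_exp :: "ereal \<Rightarrow> ennreal" where
  "ext_exp t = (if t = - \<infinity> then 0 else if t = \<infinity> then \<infinity> else ennreal (exp (real_of_ereal t)))"

definition log_laplace :: "'a::euclidean_space measure \<Rightarrow> 'a \<Rightarrow> ereal" where
  "log_laplace \<mu> \<xi> = ext_ln (\<integral>\<^sup>+z. ennreal (exp (\<xi> \<bullet> z)) \<partial>\<mu>)"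

definition legendre :: "('a::euclidean_space \<Rightarrow> ereal) \<Rightarrow> 'a \<Rightarrow> ereal" where
  "legendre f x = (SUP \<xi>. ereal (x \<bullet> \<xi>) - f \<xi>)"

definition cramer_transform :: "'a::euclidean_space measure \<Rightarrow> 'a \<Rightarrow> ereal" where
  "cramer_transform \<mu> = legendre (log_laplace \<mu>)"

text \<open>Hyperplanes are affine. For an empty \<open>A\<close> or \<open>B\<close> the inequality is trivial, as
  \<open>0 powr l = 0\<close>.\<close>

definition log_concave_prob :: "'a::euclidean_space measure \<Rightarrow> bool" where
  "log_concave_prob \<mu> \<longleftrightarrow>
     prob_space \<mu> \<and> sets \<mu> = sets borel \<and>
     (\<forall>a b. a \<noteq> 0 \<longrightarrow> measure \<mu> {x. a \<bullet> x = b} < 1) \<and>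
     (\<forall>A B l. compact A \<longrightarrow> compact B \<longrightarrow> 0 < l \<longrightarrow> l < 1 \<longrightarrow>
        measure \<mu> {l *\<^sub>R x + (1 - l) *\<^sub>R y | x y. x \<in> A \<and> y \<in> B}
          \<ge> measure \<mu> A powr l * measure \<mu> B powr (1 - l))"

text \<open>Integrability is required explicitly because the Bochner integral of a non-integrable
  function is 0 by convention.\<close>

definition centered :: "'a::euclidean_space measure \<Rightarrow> bool" where
  "centered \<mu> \<longleftrightarrow> integrable \<mu> (\<lambda>x. x) \<and> (\<integral>x. x \<partial>\<mu>) = 0"

end

theory Submission
  imports Defs
begin

text \<open>
  Idea. With \<open>n\<close> the dimension, one shows
  \<open>\<mu> {\<Lambda>* > s} \<le> 3 n exp (- s / (2 n)) + 2 ^ n exp (- s / 4)\<close> and integrates this tail bound.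

  Suppose first that \<open>\<mu>\<close> has a log-concave density \<open>f\<close> with supremum \<open>M\<close>. Substituting
  \<open>z = (1 - d) x + d w\<close> in the Laplace transform and using \<open>exp t \<ge> 1 + t\<close> with the centering gives
  \<open>\<Lambda>* ((1 - d) x) \<le> n ln (1 / d) + (1 - d) ln (M / f x)\<close>. So \<open>{\<Lambda>* > s}\<close> misses the contraction by
  \<open>1 - d\<close> of a level set of \<open>f\<close>, where \<open>d = exp (- s / (2 n))\<close>. The contraction costs little mass
  because \<open>f 0 \<ge> M / 4 ^ n\<close>, which is Jensen's inequality for the convex function \<open>f powr (-1/2)\<close>.

  In general, replace \<open>\<mu>\<close> by its convolution with the uniform distribution on a ball of radius \<open>r\<close>,
  whose density \<open>x \<mapsto> \<mu> (cball x r) / vol (cball 0 r)\<close> is log-concave directly from the definition,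
  and let \<open>r\<close> tend to 0.
\<close>

section \<open>Affine substitution, the Laplace transform and its tail sets\<close>

lemma nn_integral_lborel_affine:
  fixes t :: "'a::euclidean_space" and g :: "'a \<Rightarrow> ennreal"
  assumes [measurable]: "g \<in> borel_measurable borel" and "c \<noteq> 0"
  shows "(\<integral>\<^sup>+x. g x \<partial>lborel) = ennreal (\<bar>c\<bar> ^ DIM('a)) * (\<integral>\<^sup>+x. g (t + c *\<^sub>R x) \<partial>lborel)"
proof -
  have "(\<integral>\<^sup>+x. g x \<partial>lborel) = (\<integral>\<^sup>+x. g x \<partial>density (distr lborel borel (\<lambda>x. t + c *\<^sub>R x)) (\<lambda>_. \<bar>c\<bar> ^ DIM('a)))"
    using lborel_affine[OF assms(2), of t] by simp
  also have "\<dots> = (\<integral>\<^sup>+x. ennreal (\<bar>c\<bar> ^ DIM('a)) * g (t + c *\<^sub>R x) \<partial>lborel)"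
    by (subst nn_integral_density) (auto simp: nn_integral_distr)
  also have "\<dots> = ennreal (\<bar>c\<bar> ^ DIM('a)) * (\<integral>\<^sup>+x. g (t + c *\<^sub>R x) \<partial>lborel)"
    by (rule nn_integral_cmult) auto
  finally show ?thesis .
qed

text \<open>This is \<open>log_laplace\<close> before the logarithm is taken. In
  \<open>ennreal\<close> an infinite value enters products and inequalities directly.\<close>

definition laplace :: "'a::euclidean_space measure \<Rightarrow> 'a \<Rightarrow> ennreal" where
  "laplace \<mu> \<xi> = (\<integral>\<^sup>+z. ennreal (exp (\<xi> \<bullet> z)) \<partial>\<mu>)"

text \<open>This is the set where \<open>\<Lambda>*\<close> exceeds \<open>s\<close>, stated without \<^typ>\<open>ereal\<close>.\<close>

definition tail :: "'a::euclidean_space measure \<Rightarrow> real \<Rightarrow> 'a set" where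
  "tail \<mu> s = {x. \<exists>\<xi>. laplace \<mu> \<xi> < ennreal (exp (\<xi> \<bullet> x - s))}"

lemma open_laplace_less: "open {x. laplace \<mu> \<xi> < ennreal (exp (\<xi> \<bullet> x - s))}"
proof (cases "laplace \<mu> \<xi>")
  case (real r)
  have "{x. laplace \<mu> \<xi> < ennreal (exp (\<xi> \<bullet> x - s))} = {x. r < exp (\<xi> \<bullet> x - s)}"
    using real by (auto simp: ennreal_less_iff)
  then show ?thesis
    by (auto intro!: open_Collect_less continuous_intros)
qed simp

text \<open>Uncountably many \<xi> are involved, so measurability of the tail is drawn from openness
  of the union.\<close>

lemma open_tail: "open (tail \<mu> s)"
proof -
  have "tail \<mu> s = (\<Union>\<xi>. {x. laplace \<mu> \<xi> < ennreal (exp (\<xi> \<bullet> x - s))})"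
    by (auto simp: tail_def)
  then show ?thesis
    by (auto intro!: open_UN open_laplace_less)
qed

subsection \<open>Log-concave densities\<close>

text \<open>These are the properties that smoothing delivers. Boundedness makes the supremum
  \<open>M\<close> a real number; \<open>f_barycenter\<close> records integrability and centering
  together, one linear functional at a time.\<close>

locale log_concave_density =
  fixes f :: "'a::euclidean_space \<Rightarrow> real"
  assumes f_measurable [measurable]: "f \<in> borel_measurable borel"
    and f_nonneg: "0 \<le> f x"
    and f_bounded: "bdd_above (range f)"
    and f_log_concave: "0 < l \<Longrightarrow> l < 1 \<Longrightarrow> f x powr l * f y powr (1 - l) \<le> f (l *\<^sub>R x + (1 - l) *\<^sub>R y)"
    and nn_integral_f: "(\<integral>\<^sup>+x. ennreal (f x) \<partial>lborel) = 1"
    and f_barycenter: "has_bochner_integral lborel (\<lambda>x. f x * (v \<bullet> x)) 0"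
begin

definition M :: real where "M = (SUP x. f x)"

definition \<nu> :: "'a measure" where "\<nu> = density lborel (\<lambda>x. ennreal (f x))"

lemma f_le_M: "f x \<le> M"
  unfolding M_def by (rule cSUP_upper[OF _ f_bounded]) simp

lemma has_integral_f: "has_bochner_integral lborel f 1"
  using nn_integral_f f_nonneg by (intro has_bochner_integral_nn_integral) auto

lemma ex_pos: "\<exists>x. 0 < f x"
proof (rule ccontr)
  assume "\<not> ?thesis"
  then have "\<And>x. f x = 0" using f_nonneg by (metis less_eq_real_def)
  then show False using nn_integral_f by simp
qed

lemma M_pos: "0 < M"
  using ex_pos f_le_M by (meson less_le_trans)

section \<open>The integral of the square root of the density\<close>

lemma sqrt_midpoint: "sqrt (f x) * sqrt (f y) \<le> f ((1/2) *\<^sub>R x + (1/2) *\<^sub>R y)"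
  using f_log_concave[of "1/2" x y] f_nonneg by (simp add: powr_half_sqrt)

text \<open>The midpoint inequality is integrated over \<open>x\<close> with \<open>y\<close> fixed;
  undoing the map from \<open>x\<close> to the midpoint costs the factor
  \<open>2 ^ DIM('a)\<close>.\<close>

lemma nn_integral_sqrt_f: "(\<integral>\<^sup>+x. ennreal (sqrt (f x)) \<partial>lborel) * ennreal (sqrt (f y)) \<le> ennreal (2 ^ DIM('a))"
proof -
  have "(\<integral>\<^sup>+x. ennreal (sqrt (f x)) \<partial>lborel) * ennreal (sqrt (f y)) = (\<integral>\<^sup>+x. ennreal (sqrt (f x) * sqrt (f y)) \<partial>lborel)"
    using f_nonneg by (subst nn_integral_multc[symmetric]) (auto simp: ennreal_mult)
  also have "\<dots> \<le> (\<integral>\<^sup>+x. ennreal (f ((1/2) *\<^sub>R x + (1/2) *\<^sub>R y)) \<partial>lborel)"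
    by (intro nn_integral_mono ennreal_leI sqrt_midpoint)
  also have "\<dots> = ennreal (2 ^ DIM('a)) * (\<integral>\<^sup>+x. ennreal (f x) \<partial>lborel)"
    by (subst nn_integral_lborel_affine[where c=2 and t="- y"]) (auto simp: algebra_simps)
  finally show ?thesis by (simp add: nn_integral_f)
qed

lemma integrable_sqrt_f: "integrable lborel (\<lambda>x. sqrt (f x))"
proof -
  obtain y where y: "0 < f y" using ex_pos by blast
  have "(\<integral>\<^sup>+x. ennreal (sqrt (f x)) \<partial>lborel) \<noteq> \<infinity>"
  proof
    assume "(\<integral>\<^sup>+x. ennreal (sqrt (f x)) \<partial>lborel) = \<infinity>"
    with nn_integral_sqrt_f[of y] y show False by (simp add: ennreal_top_mult top_unique)
  qed
  then show ?thesis
    using f_nonneg by (intro integrableI_nonneg) (auto simp: less_top)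
qed

text \<open>Take the supremum over \<open>y\<close> in the preceding bound. The estimate is used
  twice: for the value of \<open>f\<close> at the origin and for the mass where \<open>f\<close> is
  small.\<close>

lemma integral_sqrt_f_mult: "(\<integral>x. sqrt (f x) \<partial>lborel) * sqrt M \<le> 2 ^ DIM('a)"
proof -
  define I where "I = (\<integral>x. sqrt (f x) \<partial>lborel)"
  have I0: "0 \<le> I" unfolding I_def using f_nonneg by (intro integral_nonneg_AE) auto
  have *: "I * sqrt (f y) \<le> 2 ^ DIM('a)" for y
  proof -
    have "ennreal (I * sqrt (f y)) = (\<integral>\<^sup>+x. ennreal (sqrt (f x)) \<partial>lborel) * ennreal (sqrt (f y))"
      unfolding I_def using f_nonneg I0
      by (subst nn_integral_eq_integral[OF integrable_sqrt_f]) (auto simp: I_def ennreal_mult)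
    also note nn_integral_sqrt_f
    finally show ?thesis by (simp add: ennreal_le_iff)
  qed
  show ?thesis
  proof (cases "I = 0")
    case False
    have "f y \<le> (2 ^ DIM('a) / I)\<^sup>2" for y
    proof -
      have "sqrt (f y) \<le> 2 ^ DIM('a) / I" using * False I0 by (simp add: field_simps)
      then show ?thesis using sqrt_le_D by blast
    qed
    then have "M \<le> (2 ^ DIM('a) / I)\<^sup>2"
      unfolding M_def by (intro cSUP_least) auto
    then have "sqrt M \<le> 2 ^ DIM('a) / I"
      using I0 by (simp add: real_le_lsqrt)
    then show ?thesis using False I0 unfolding I_def[symmetric] by (simp add: field_simps)
  qed (simp add: I_def)
qed

section \<open>The density at the barycenter\<close>

lemma inverse_sqrt_convex:
  assumes "0 < f x" "0 < f y" "0 \<le> u" "0 \<le> v" "u + v = 1"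
  shows "0 < f (u *\<^sub>R x + v *\<^sub>R y)" "1 / sqrt (f (u *\<^sub>R x + v *\<^sub>R y)) \<le> u / sqrt (f x) + v / sqrt (f y)"
proof -
  have "0 < f (u *\<^sub>R x + v *\<^sub>R y) \<and> 1 / sqrt (f (u *\<^sub>R x + v *\<^sub>R y)) \<le> u / sqrt (f x) + v / sqrt (f y)"
  proof (cases "u = 0 \<or> u = 1")
    case True
    then show ?thesis using assms by auto
  next
    case False
    then have u: "0 < u" "u < 1" and v: "v = 1 - u" using assms by auto
    \<comment> \<open>With \<open>f\<close> written as \<open>exp a\<close>, the function
      \<open>1 / sqrt f\<close> is \<open>exp (- a / 2)\<close>. Log-concavity bounds the exponent
      at the combined point, and convexity of \<open>exp\<close> does the rest.\<close>
    define a b where "a = ln (f x)" and "b = ln (f y)"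
    have ab: "f x = exp a" "f y = exp b" using assms by (auto simp: a_def b_def)
    have le: "exp (u * a + v * b) \<le> f (u *\<^sub>R x + v *\<^sub>R y)"
      using f_log_concave[OF u, of x y] by (simp add: ab v powr_def exp_add)
    have sq: "1 / sqrt (exp t) = exp (- t / 2)" for t :: real
    proof -
      have "sqrt (exp t) = exp (t / 2)"
        by (rule real_sqrt_unique) (auto simp: power2_eq_square simp flip: exp_add)
      then show ?thesis by (simp add: exp_minus field_simps)
    qed
    have pos: "0 < f (u *\<^sub>R x + v *\<^sub>R y)" using le by (smt (verit) exp_gt_zero)
    have sq': "t / sqrt (exp r) = t * exp (- r / 2)" for t r :: real
      using sq[of r] by (metis mult.right_neutral times_divide_eq_right)
    have "1 / sqrt (f (u *\<^sub>R x + v *\<^sub>R y)) \<le> 1 / sqrt (exp (u * a + v * b))"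
      using le pos by (intro divide_left_mono) auto
    also have "\<dots> = exp ((1 - u) * (- b / 2) + u * (- a / 2))"
      unfolding sq by (simp add: v field_simps)
    also have "\<dots> \<le> (1 - u) * exp (- b / 2) + u * exp (- a / 2)"
      using convex_onD[OF exp_convex, of u "- b / 2" "- a / 2"] u by simp
    also have "\<dots> = u / sqrt (f x) + v / sqrt (f y)"
      by (simp add: ab v sq')
    finally show ?thesis using pos by simp
  qed
  then show "0 < f (u *\<^sub>R x + v *\<^sub>R y)" "1 / sqrt (f (u *\<^sub>R x + v *\<^sub>R y)) \<le> u / sqrt (f x) + v / sqrt (f y)"
    by auto
qed

text \<open>Jensen bounds \<open>1 / sqrt (f 0)\<close> by the \<nu>-mean of
  \<open>1 / sqrt f\<close>, which is the integral of \<open>sqrt f\<close> and hence at most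
  \<open>2 ^ DIM('a) / sqrt M\<close>. As \<open>1 / sqrt f\<close> is infinite where
  \<open>f\<close> vanishes, Jensen is carried out by hand with a separating hyperplane.\<close>

lemma f_0_lower: "M / 4 ^ DIM('a) \<le> f 0"
proof (rule ccontr)
  define I where "I = (\<integral>x. sqrt (f x) \<partial>lborel)"
  assume "\<not> ?thesis"
  then have small: "f 0 < M / 4 ^ DIM('a)" by simp
  have I_le: "I \<le> 2 ^ DIM('a) / sqrt M"
    using integral_sqrt_f_mult M_pos by (simp add: I_def field_simps)
  \<comment> \<open>The point at height \<open>c\<close> over the origin lies strictly below the
    graph of \<open>1 / sqrt f\<close>, yet \<open>c\<close> exceeds the mean \<open>I\<close>. If
    \<open>f 0\<close> vanishes, any \<open>c\<close> above \<open>I\<close> will do.\<close>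
  have ex_c: "\<exists>c. I < c \<and> \<not> (0 < f 0 \<and> 1 / sqrt (f 0) \<le> c)"
  proof (cases "0 < f 0")
    case True
    have "sqrt (f 0) < sqrt (M / 4 ^ DIM('a))" using small by simp
    also have "\<dots> = sqrt M / 2 ^ DIM('a)"
      by (simp add: real_sqrt_divide real_sqrt_power)
    finally have "2 ^ DIM('a) / sqrt M < 1 / sqrt (f 0)"
      using True M_pos by (simp add: field_simps)
    with I_le have "I < 1 / sqrt (f 0)" by simp
    then show ?thesis using dense by (metis not_less)
  qed (use gt_ex in blast)
  then obtain c where c: "I < c" "\<not> (0 < f 0 \<and> 1 / sqrt (f 0) \<le> c)" by blast
  \<comment> \<open>\<open>S\<close> is the epigraph of \<open>1 / sqrt f\<close> shifted by \<open>c\<close>; integrating the linear functional that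
    separates it from 0 against \<open>f\<close> forces its last coordinate to vanish.\<close>
  define S where "S = {(x, t). 0 < f x \<and> 1 / sqrt (f x) \<le> t + c}"
  have "convex S"
  proof (rule convexI, clarify)
    fix x1 t1 x2 t2 and u v :: real
    assume S: "(x1, t1) \<in> S" "(x2, t2) \<in> S" and uv: "0 \<le> u" "0 \<le> v" "u + v = 1"
    have f: "0 < f x1" "0 < f x2" using S by (auto simp: S_def)
    have "u * (1 / sqrt (f x1)) + v * (1 / sqrt (f x2)) \<le> u * (t1 + c) + v * (t2 + c)"
      using S uv by (intro add_mono mult_left_mono) (auto simp: S_def)
    also have "\<dots> = u * t1 + v * t2 + (u + v) * c" by (simp add: algebra_simps)
    finally have "u / sqrt (f x1) + v / sqrt (f x2) \<le> u * t1 + v * t2 + c" by (simp add: uv)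
    with inverse_sqrt_convex[OF f uv]
    show "u *\<^sub>R (x1, t1) + v *\<^sub>R (x2, t2) \<in> S"
      by (auto simp: S_def)
  qed
  moreover have "0 \<notin> S" using c(2) by (auto simp: S_def zero_prod_def)
  ultimately obtain p where p: "p \<noteq> 0" "\<And>z. z \<in> S \<Longrightarrow> 0 \<le> p \<bullet> z"
    using separating_hyperplane_set_0 by metis
  obtain v \<tau> where vt: "p = (v, \<tau>)" by fastforce
  have sep: "0 \<le> v \<bullet> x + \<tau> * t" if "0 < f x" "1 / sqrt (f x) \<le> t + c" for x t
    using p(2)[of "(x, t)"] that by (auto simp: S_def vt)
  \<comment> \<open>The epigraph is unbounded upwards; for negative \<tau> the chosen height makes
    the functional at most -1.\<close>
  have "0 \<le> \<tau>"
  proof (rule ccontr)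
    assume "\<not> 0 \<le> \<tau>"
    then have \<tau>: "\<tau> < 0" by simp
    obtain x where x: "0 < f x" using ex_pos by blast
    define t where "t = max (1 / sqrt (f x) - c) (- (v \<bullet> x + 1) / \<tau>)"
    have "0 \<le> v \<bullet> x + \<tau> * t" by (rule sep[OF x]) (simp add: t_def)
    moreover have "\<tau> * t \<le> \<tau> * (- (v \<bullet> x + 1) / \<tau>)"
      using \<tau> by (intro mult_left_mono_neg) (auto simp: t_def)
    ultimately show False using \<tau> by simp
  qed
  \<comment> \<open>The separation inequality at the lowest point of the epigraph over
    \<open>x\<close>, multiplied by \<open>f x\<close>.\<close>
  have nonneg: "0 \<le> f x * (v \<bullet> x) + \<tau> * (sqrt (f x) - c * f x)" for x
  proof (cases "0 < f x")
    case True
    have "0 \<le> f x * (v \<bullet> x + \<tau> * (1 / sqrt (f x) - c))"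
      using sep[of x "1 / sqrt (f x) - c"] True by (intro mult_nonneg_nonneg) auto
    moreover have "f x * (v \<bullet> x + \<tau> * (1 / sqrt (f x) - c)) = f x * (v \<bullet> x) + \<tau> * (f x / sqrt (f x) - c * f x)"
      by (simp add: algebra_simps)
    moreover have "f x / sqrt (f x) = sqrt (f x)"
      using True by (simp add: real_div_sqrt)
    ultimately show ?thesis by simp
  next
    case False
    then have "f x = 0" using f_nonneg[of x] by simp
    then show ?thesis by simp
  qed
  have sqrtI: "has_bochner_integral lborel (\<lambda>x. sqrt (f x)) I"
    unfolding I_def by (rule has_bochner_integral_integrable[OF integrable_sqrt_f])
  have hI: "has_bochner_integral lborel (\<lambda>x. f x * (v \<bullet> x) + \<tau> * (sqrt (f x) - c * f x)) (0 + \<tau> * (I - c * 1))"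
    by (intro has_bochner_integral_add has_bochner_integral_mult_right has_bochner_integral_diff
          f_barycenter has_integral_f sqrtI)
  have "0 \<le> (\<integral>x. f x * (v \<bullet> x) + \<tau> * (sqrt (f x) - c * f x) \<partial>lborel)"
    by (rule integral_nonneg_AE) (use nonneg in auto)
  \<comment> \<open>Centering has removed the term in \<open>v\<close>. Since \<open>I < c\<close>,
    the remaining \<open>\<tau> * (I - c)\<close> is nonnegative only for \<tau> equal to 0.\<close>
  then have "0 \<le> 0 + \<tau> * (I - c * 1)"
    by (simp only: has_bochner_integral_integral_eq[OF hI])
  then have "\<tau> = 0" using \<open>0 \<le> \<tau>\<close> c(1) by (auto simp: zero_le_mult_iff)
  then have "v \<noteq> 0" using p(1) vt by (auto simp: zero_prod_def)
  \<comment> \<open>What is left is nonnegative with integral 0, so it vanishes almost everywhere.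
    The hyperplane orthogonal to \<open>v\<close> is a null set, so \<open>f\<close> would vanish
    almost everywhere too.\<close>
  have "AE x in lborel. f x * (v \<bullet> x) = 0"
    using nonneg \<open>\<tau> = 0\<close> f_barycenter[of v]
    by (subst integral_nonneg_eq_0_iff_AE[symmetric]) (auto simp: has_bochner_integral_iff)
  moreover have "AE x in lborel. v \<bullet> x \<noteq> 0"
  proof -
    have "{x. v \<bullet> x = 0} \<in> null_sets lborel"
      using negligible_hyperplane[of v 0] \<open>v \<noteq> 0\<close>
      by (auto simp: negligible_iff_null_sets null_sets_completion_iff)
    then show ?thesis by (auto intro: AE_I')
  qed
  ultimately have "AE x in lborel. f x = 0" by eventually_elim auto
  then have "(\<integral>\<^sup>+x. ennreal (f x) \<partial>lborel) = 0"
    by (subst nn_integral_0_iff_AE) auto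
  then show False using nn_integral_f by simp
qed

section \<open>Lower bounds for the Laplace transform\<close>

lemma laplace_\<nu>: "laplace \<nu> \<xi> = (\<integral>\<^sup>+x. ennreal (exp (\<xi> \<bullet> x) * f x) \<partial>lborel)"
  unfolding laplace_def \<nu>_def using f_nonneg
  by (subst nn_integral_density) (auto simp: ennreal_mult mult.commute)

text \<open>Integrate \<open>exp t \<ge> 1 + t\<close>: the linear term has integral 0 by
  centering.\<close>

lemma laplace_\<nu>_ge_1: "1 \<le> laplace \<nu> \<xi>"
proof (cases "laplace \<nu> \<xi> = \<infinity>")
  case False
  have int: "integrable lborel (\<lambda>x. exp (\<xi> \<bullet> x) * f x)"
    using False f_nonneg by (intro integrableI_nonneg) (auto simp: laplace_\<nu> less_top)
  have h: "has_bochner_integral lborel (\<lambda>x. f x + f x * (\<xi> \<bullet> x)) (1 + 0)"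
    by (intro has_bochner_integral_add has_integral_f f_barycenter)
  then have "1 = (\<integral>x. f x + f x * (\<xi> \<bullet> x) \<partial>lborel)"
    by (simp add: has_bochner_integral_iff)
  also have "\<dots> \<le> (\<integral>x. exp (\<xi> \<bullet> x) * f x \<partial>lborel)"
  proof (rule integral_mono[OF _ int])
    show "integrable lborel (\<lambda>x. f x + f x * (\<xi> \<bullet> x))" using h by (simp add: has_bochner_integral_iff)
    show "f x + f x * (\<xi> \<bullet> x) \<le> exp (\<xi> \<bullet> x) * f x" for x
      using mult_right_mono[OF exp_ge_add_one_self[of "\<xi> \<bullet> x"] f_nonneg[of x]] by (simp add: algebra_simps)
  qed
  finally have "1 \<le> ennreal (\<integral>x. exp (\<xi> \<bullet> x) * f x \<partial>lborel)" by (simp add: ennreal_ge_1)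
  also have "\<dots> = laplace \<nu> \<xi>"
    unfolding laplace_\<nu> using int f_nonneg by (subst nn_integral_eq_integral) auto
  finally show ?thesis .
qed simp

text \<open>Substitute \<open>z = (1 - d) x + d w\<close>. Log-concavity and
  \<open>f w \<le> M\<close> bound \<open>f z\<close> below by
  \<open>(f x / M) powr (1 - d) * f w\<close>, and the remaining integral over \<open>w\<close> is
  the Laplace transform at \<open>d *\<^sub>R \<xi>\<close>, which is at least 1. The Jacobian gives
  \<open>d ^ DIM('a)\<close>.\<close>

lemma laplace_\<nu>_lower:
  assumes d: "0 < d" "d < 1"
  shows "ennreal (d ^ DIM('a) * (f x / M) powr (1 - d) * exp (\<xi> \<bullet> ((1 - d) *\<^sub>R x))) \<le> laplace \<nu> \<xi>"
proof -
  define C where "C = (f x / M) powr (1 - d) * exp (\<xi> \<bullet> ((1 - d) *\<^sub>R x))"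
  have C0: "0 \<le> C" by (simp add: C_def)
  have pw: "C * (exp ((d *\<^sub>R \<xi>) \<bullet> w) * f w)
      \<le> exp (\<xi> \<bullet> ((1 - d) *\<^sub>R x + d *\<^sub>R w)) * f ((1 - d) *\<^sub>R x + d *\<^sub>R w)" for w
  proof -
    \<comment> \<open>Splitting \<open>f w\<close> as \<open>f w powr d * f w powr (1 - d)\<close>,
      only the second factor is bounded by a power of \<open>M\<close>; the full \<open>f w\<close>
      is kept for the integral.\<close>
    have "f w / M powr (1 - d) \<le> f w powr d"
    proof (cases "f w = 0")
      case False
      then have fw: "0 < f w" using f_nonneg[of w] by simp
      have "f w / M powr (1 - d) \<le> f w / f w powr (1 - d)"
        using fw d f_le_M M_pos by (intro divide_left_mono powr_mono2) auto
      also have "\<dots> = f w powr d" using fw by (simp add: powr_diff)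
      finally show ?thesis .
    qed simp
    then have "f x powr (1 - d) * (f w / M powr (1 - d)) \<le> f x powr (1 - d) * f w powr d"
      by (rule mult_left_mono) simp
    also have "\<dots> \<le> f ((1 - d) *\<^sub>R x + d *\<^sub>R w)"
      using f_log_concave[of "1 - d" x w] d by simp
    finally have "exp (\<xi> \<bullet> ((1 - d) *\<^sub>R x + d *\<^sub>R w)) * (f x powr (1 - d) * (f w / M powr (1 - d)))
        \<le> exp (\<xi> \<bullet> ((1 - d) *\<^sub>R x + d *\<^sub>R w)) * f ((1 - d) *\<^sub>R x + d *\<^sub>R w)"
      by (rule mult_left_mono) simp
    then show ?thesis
      using f_nonneg[of x] M_pos
      by (simp add: C_def powr_divide inner_add_right exp_add mult_ac)
  qed
  have "ennreal (d ^ DIM('a) * (f x / M) powr (1 - d) * exp (\<xi> \<bullet> ((1 - d) *\<^sub>R x))) = ennreal (d ^ DIM('a)) * (ennreal C * 1)"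
    using d C0 by (simp add: C_def ennreal_mult' mult.assoc)
  also have "\<dots> \<le> ennreal (d ^ DIM('a)) * (ennreal C * laplace \<nu> (d *\<^sub>R \<xi>))"
    by (intro mult_left_mono laplace_\<nu>_ge_1) auto
  also have "ennreal C * laplace \<nu> (d *\<^sub>R \<xi>) = (\<integral>\<^sup>+w. ennreal (C * (exp ((d *\<^sub>R \<xi>) \<bullet> w) * f w)) \<partial>lborel)"
    unfolding laplace_\<nu> using C0 f_nonneg
    by (subst nn_integral_cmult[symmetric]) (auto simp: ennreal_mult)
  also have "\<dots> \<le> (\<integral>\<^sup>+w. ennreal (exp (\<xi> \<bullet> ((1 - d) *\<^sub>R x + d *\<^sub>R w)) * f ((1 - d) *\<^sub>R x + d *\<^sub>R w)) \<partial>lborel)"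
    by (intro nn_integral_mono ennreal_leI pw)
  also have "ennreal (d ^ DIM('a)) * \<dots> = laplace \<nu> \<xi>"
    unfolding laplace_\<nu> using d
    by (subst nn_integral_lborel_affine[where c=d and t="(1 - d) *\<^sub>R x"]) auto
  finally show ?thesis by (simp add: mult_left_mono)
qed


section \<open>The tail estimate for a log-concave density\<close>

lemma prob_space_\<nu>: "prob_space \<nu>"
  by (rule prob_spaceI) (simp add: \<nu>_def emeasure_density nn_integral_f)

lemma sets_\<nu> [simp, measurable_cong]: "sets \<nu> = sets borel"
  by (simp add: \<nu>_def)

lemma space_\<nu> [simp]: "space \<nu> = UNIV"
  by (simp add: \<nu>_def)

text \<open>Where \<open>f < M * e\<close>, one has \<open>f \<le> sqrt (M * e) * sqrt f\<close>,
  and the integral of \<open>sqrt f\<close> is already controlled.\<close>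

lemma measure_\<nu>_low:
  assumes "0 < e"
  shows "measure \<nu> {x. f x < M * e} \<le> 2 ^ DIM('a) * sqrt e"
proof -
  interpret prob_space \<nu> by (rule prob_space_\<nu>)
  have pw: "f x * indicator {x. f x < M * e} x \<le> sqrt (M * e) * sqrt (f x)" for x
  proof (cases "f x < M * e")
    case True
    have "f x = sqrt (f x) * sqrt (f x)" using f_nonneg by simp
    also have "\<dots> \<le> sqrt (M * e) * sqrt (f x)"
      using True f_nonneg by (intro mult_right_mono) auto
    finally show ?thesis using True by simp
  qed (use f_nonneg M_pos assms in auto)
  have "emeasure \<nu> {x. f x < M * e} = (\<integral>\<^sup>+x. ennreal (f x * indicator {x. f x < M * e} x) \<partial>lborel)"
    unfolding \<nu>_def
    by (subst emeasure_density) (auto intro!: nn_integral_cong split: split_indicator)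
  also have "\<dots> \<le> (\<integral>\<^sup>+x. ennreal (sqrt (M * e) * sqrt (f x)) \<partial>lborel)"
    by (intro nn_integral_mono ennreal_leI pw)
  also have "\<dots> = ennreal (sqrt (M * e) * (\<integral>x. sqrt (f x) \<partial>lborel))"
    using integrable_sqrt_f f_nonneg M_pos assms by (subst nn_integral_eq_integral) auto
  also have "\<dots> \<le> ennreal (2 ^ DIM('a) * sqrt e)"
    using mult_right_mono[OF integral_sqrt_f_mult, of "sqrt e"] assms
    by (intro ennreal_leI) (simp add: real_sqrt_mult mult_ac)
  finally show ?thesis
    using assms by (simp add: emeasure_eq_measure ennreal_le_iff)
qed

text \<open>The set on the right is \<open>(1 - d) S\<close>. Log-concavity between \<open>x\<close>
  and 0, with \<open>f x \<le> M \<le> 4 ^ DIM('a) * f 0\<close>, shows that \<open>f\<close> drops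
  by at most the factor \<open>C\<close> under the contraction, while volume shrinks by
  \<open>(1 - d) ^ DIM('a)\<close>. Bernoulli's inequality makes the total loss linear in
  \<open>d\<close>.\<close>

lemma measure_\<nu>_contract:
  fixes d :: real
  assumes [measurable]: "S \<in> sets borel" and S: "\<And>x. x \<in> S \<Longrightarrow> 0 < f x" and d: "0 < d" "d < 1"
  shows "measure \<nu> S - 3 * DIM('a) * d \<le> measure \<nu> {y. (1 / (1 - d)) *\<^sub>R y \<in> S}"
\<comment> \<open>Bernoulli's inequality is applied to \<open>1 - 3 * d\<close>, which must be
  nonnegative; otherwise the left-hand side of the claim is at most 0.\<close>
proof (cases "3 * d \<le> 1")
  case False
  interpret prob_space \<nu> by (rule prob_space_\<nu>)
  have "1 \<le> real DIM('a)" using DIM_positive[where 'a='a] by linarith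
  then have "1 * 1 \<le> DIM('a) * (3 * d)" using False by (intro mult_mono) auto
  then have "1 \<le> 3 * DIM('a) * d" by (simp add: mult_ac)
  with prob_le_1[of S] have "measure \<nu> S \<le> 3 * DIM('a) * d" by linarith
  then show ?thesis by (smt (verit) measure_nonneg)
next
  case True
  interpret prob_space \<nu> by (rule prob_space_\<nu>)
  define C where "C = (1 / 4 ^ DIM('a)) powr d"
  have pw: "C * (f x * indicator S x) \<le> f ((1 - d) *\<^sub>R x) * indicator S x" for x
  proof (cases "x \<in> S")
    case x: True
    have "f x * C \<le> f x * (f 0 / f x) powr d"
    proof -
      have "1 / 4 ^ DIM('a) \<le> f 0 / f x"
      proof -
        have "f x / 4 ^ DIM('a) \<le> M / 4 ^ DIM('a)" using f_le_M by (simp add: divide_right_mono)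
        with f_0_lower have "f x / 4 ^ DIM('a) \<le> f 0" by linarith
        then show ?thesis using S[OF x] by (simp add: field_simps)
      qed
      then show ?thesis unfolding C_def using d S[OF x] by (intro mult_left_mono powr_mono2) auto
    qed
    also have "\<dots> = f x powr (1 - d) * f 0 powr (1 - (1 - d))"
      using S[OF x] f_nonneg by (simp add: powr_divide powr_diff)
    also have "\<dots> \<le> f ((1 - d) *\<^sub>R x)"
      using f_log_concave[of "1 - d" x 0] d by simp
    finally show ?thesis using x by (simp add: mult.commute)
  qed simp
  have "1 - 3 * DIM('a) * d \<le> (1 - 3 * d) ^ DIM('a)"
    using Bernoulli_inequality[of "- (3 * d)" "DIM('a)"] True by (simp add: mult_ac)
  also have "\<dots> \<le> ((1 - d) * (1 / 4) powr d) ^ DIM('a)"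
  proof (rule power_mono)
    \<comment> \<open>From \<open>ln 4 \<le> 2\<close> follows
      \<open>(1/4) powr d \<ge> 1 - 2 * d\<close>, and multiplying by \<open>1 - d\<close> leaves at
      least \<open>1 - 3 * d\<close>.\<close>
    have "ln (4::real) = 2 * ln 2" using ln_realpow[of 2 2] by simp
    also have "\<dots> \<le> 2" using ln_add_one_self_le_self[of 1] by simp
    finally have "d * ln 4 \<le> d * 2" using d by (intro mult_left_mono) auto
    then have "1 - 2 * d \<le> 1 + - (d * ln 4)" by simp
    also have "\<dots> \<le> exp (- (d * ln 4))" by (rule exp_ge_add_one_self)
    also have "\<dots> = (1 / 4) powr d" by (simp add: powr_def ln_div)
    finally have "(1 - d) * (1 - 2 * d) \<le> (1 - d) * (1 / 4) powr d"
      using d by (intro mult_left_mono) auto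
    moreover have "1 - 3 * d \<le> (1 - d) * (1 - 2 * d)" by (simp add: algebra_simps)
    ultimately show "1 - 3 * d \<le> (1 - d) * (1 / 4) powr d" by linarith
  qed (use True in auto)
  also have "\<dots> = (1 - d) ^ DIM('a) * C"
  proof -
    have "((1 / 4) powr d) ^ k = (1 / 4 ^ k) powr d" for k
      by (induction k) (simp_all flip: powr_mult)
    then show ?thesis by (simp add: C_def power_mult_distrib)
  qed
  finally have coef: "1 - 3 * DIM('a) * d \<le> (1 - d) ^ DIM('a) * C" .
  \<comment> \<open>A measure at most 1 allows the additive loss to be replaced by a multiplicative
    one.\<close>
  have "measure \<nu> S - 3 * DIM('a) * d \<le> measure \<nu> S * (1 - 3 * DIM('a) * d)"
    using d prob_le_1[of S] by (simp add: algebra_simps mult_left_le_one_le)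
  also have "\<dots> \<le> measure \<nu> S * ((1 - d) ^ DIM('a) * C)"
    by (rule mult_left_mono[OF coef]) simp
  finally have 1: "measure \<nu> S - 3 * DIM('a) * d \<le> measure \<nu> S * ((1 - d) ^ DIM('a) * C)" .
  have "ennreal (measure \<nu> S * ((1 - d) ^ DIM('a) * C)) = ennreal ((1 - d) ^ DIM('a)) * (ennreal C * emeasure \<nu> S)"
    using d by (simp add: C_def emeasure_eq_measure ennreal_mult mult_ac)
  also have "ennreal C * emeasure \<nu> S = (\<integral>\<^sup>+x. ennreal (C * (f x * indicator S x)) \<partial>lborel)"
    unfolding \<nu>_def using f_nonneg
    by (subst emeasure_density, simp, simp, subst nn_integral_cmult[symmetric])
       (auto intro!: nn_integral_cong simp: C_def ennreal_mult split: split_indicator)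
  also have "\<dots> \<le> (\<integral>\<^sup>+x. ennreal (f ((1 - d) *\<^sub>R x) * indicator S x) \<partial>lborel)"
    by (intro nn_integral_mono ennreal_leI pw)
  also have "ennreal ((1 - d) ^ DIM('a)) * \<dots>
      = (\<integral>\<^sup>+y. ennreal (f y * indicator S ((1 / (1 - d)) *\<^sub>R y)) \<partial>lborel)"
    using d by (subst (2) nn_integral_lborel_affine[where c="1 - d" and t=0]) auto
  also have "\<dots> = emeasure \<nu> {y. (1 / (1 - d)) *\<^sub>R y \<in> S}"
    unfolding \<nu>_def
    by (subst emeasure_density) (auto intro!: nn_integral_cong split: split_indicator)
  finally have "measure \<nu> S * ((1 - d) ^ DIM('a) * C) \<le> measure \<nu> {y. (1 / (1 - d)) *\<^sub>R y \<in> S}"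
    by (auto simp: emeasure_eq_measure mult_left_mono)
  with 1 show ?thesis by linarith
qed

text \<open>The exponent is split evenly: \<open>d ^ DIM('a)\<close> and \<open>e\<close> both equal
  \<open>exp (- s / 2)\<close>. For \<open>x\<close> in the level set \<open>S\<close>, the lower
  bound on the Laplace transform keeps \<open>(1 - d) x\<close> out of the tail. The tail thus lies
  outside \<open>K\<close>, the contraction of \<open>S\<close>; contracting costs
  \<open>3 * DIM('a) * d\<close>, and the complement of \<open>S\<close> costs
  \<open>2 ^ DIM('a) * sqrt e\<close>.\<close>

lemma measure_\<nu>_tail:
  assumes s: "0 < s"
  shows "measure \<nu> (tail \<nu> s) \<le> 3 * DIM('a) * exp (- s / (2 * DIM('a))) + 2 ^ DIM('a) * exp (- s / 4)"
proof -
  interpret prob_space \<nu> by (rule prob_space_\<nu>)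
  define d where "d = exp (- s / (2 * DIM('a)))"
  define e where "e = exp (- s / 2)"
  have d: "0 < d" "d < 1" using s by (auto simp: d_def)
  have e: "0 < e" "e < 1" using s by (auto simp: e_def)
  define S where "S = {x. M * e \<le> f x}"
  have [measurable]: "S \<in> sets borel" unfolding S_def by measurable
  have S_pos: "0 < f x" if "x \<in> S" for x
    using that mult_pos_pos[OF M_pos e(1)] by (auto simp: S_def)
  define K where "K = {y. (1 / (1 - d)) *\<^sub>R y \<in> S}"
  have [measurable]: "K \<in> sets borel" unfolding K_def by measurable
  have disj: "y \<notin> tail \<nu> s" if "y \<in> K" for y
  proof -
    define x where "x = (1 / (1 - d)) *\<^sub>R y"
    have x: "x \<in> S" and y: "y = (1 - d) *\<^sub>R x" using that d by (auto simp: K_def x_def)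
    have "ennreal (exp (\<xi> \<bullet> y - s)) \<le> laplace \<nu> \<xi>" for \<xi>
    proof -
      have "e \<le> e powr (1 - d)"
        using powr_mono'[of "1 - d" 1 e] d e by simp
      also have "\<dots> \<le> (f x / M) powr (1 - d)"
        using x M_pos d e by (intro powr_mono2) (auto simp: S_def field_simps)
      finally have "d ^ DIM('a) * e * exp (\<xi> \<bullet> y) \<le> d ^ DIM('a) * (f x / M) powr (1 - d) * exp (\<xi> \<bullet> y)"
        using d by (intro mult_right_mono mult_left_mono) auto
      moreover have "d ^ DIM('a) * e * exp (\<xi> \<bullet> y) = exp (\<xi> \<bullet> y - s)"
      proof -
        have "d ^ DIM('a) = exp (- s / 2)"
          by (simp add: d_def flip: exp_of_nat_mult)
        then show ?thesis by (simp add: e_def flip: exp_add)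
      qed
      ultimately have "exp (\<xi> \<bullet> y - s) \<le> d ^ DIM('a) * (f x / M) powr (1 - d) * exp (\<xi> \<bullet> ((1 - d) *\<^sub>R x))"
        by (simp add: y)
      then show ?thesis using laplace_\<nu>_lower[OF d, of x \<xi>] by (meson ennreal_leI order_trans)
    qed
    then show ?thesis by (auto simp: tail_def not_less)
  qed
  have "measure \<nu> (tail \<nu> s) \<le> measure \<nu> (UNIV - K)"
    using disj by (intro finite_measure_mono) auto
  also have "\<dots> = 1 - measure \<nu> K" using prob_compl[of K] by simp
  also have "\<dots> \<le> 3 * DIM('a) * d + (1 - measure \<nu> S)"
    using measure_\<nu>_contract[OF \<open>S \<in> sets borel\<close> S_pos d] by (simp add: K_def)
  also have "1 - measure \<nu> S = measure \<nu> (UNIV - S)" using prob_compl[of S] by simp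
  also have "UNIV - S = {x. f x < M * e}" by (auto simp: S_def)
  also have "measure \<nu> {x. f x < M * e} \<le> 2 ^ DIM('a) * sqrt e"
    by (rule measure_\<nu>_low[OF e(1)])
  also have "sqrt e = exp (- s / 4)"
    unfolding e_def by (rule real_sqrt_unique) (auto simp: power2_eq_square simp flip: exp_add)
  finally show ?thesis by (simp add: d_def)
qed

end

subsection \<open>Smoothing by small balls\<close>

lemma integral_lborel_affine:
  fixes t :: "'a::euclidean_space" and g :: "'a \<Rightarrow> real"
  assumes [measurable]: "g \<in> borel_measurable borel" and "c \<noteq> 0"
  shows "(\<integral>x. g x \<partial>lborel) = \<bar>c\<bar> ^ DIM('a) * (\<integral>x. g (t + c *\<^sub>R x) \<partial>lborel)"
proof -
  have "(\<integral>x. g x \<partial>lborel) = (\<integral>x. g x \<partial>density (distr lborel borel (\<lambda>x. t + c *\<^sub>R x)) (\<lambda>_. \<bar>c\<bar> ^ DIM('a)))"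
    using lborel_affine[OF assms(2), of t] by simp
  also have "\<dots> = \<bar>c\<bar> ^ DIM('a) * (\<integral>x. g (t + c *\<^sub>R x) \<partial>lborel)"
    by (subst integral_density) (auto simp: integral_distr)
  finally show ?thesis .
qed

locale smoothed_log_concave =
  fixes \<mu> :: "'a::euclidean_space measure" and r :: real
  assumes log_concave: "log_concave_prob \<mu>" and centered: "centered \<mu>" and r_pos: "0 < r"
begin

sublocale prob_space \<mu>
  using log_concave by (simp add: log_concave_prob_def)

lemma sets_\<mu> [simp, measurable_cong]: "sets \<mu> = sets borel"
  using log_concave by (simp add: log_concave_prob_def)

lemma space_\<mu> [simp]: "space \<mu> = UNIV"
  using sets_eq_imp_space_eq[OF sets_\<mu>] by simp

sublocale P: pair_sigma_finite \<mu> "lborel :: 'a measure" ..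

section \<open>The smoothed density and its properties\<close>

lemma cball_borel [measurable]: "cball (z::'a) r \<in> sets borel"
  by (intro borel_closed closed_cball)

definition V :: real where "V = measure lborel (cball (0::'a) r)"

definition g :: "'a \<Rightarrow> real" where "g x = measure \<mu> (cball x r) / V"

lemma V_pos: "0 < V"
  using r_pos content_cball_pos unfolding V_def by (auto simp: measure_completion)

lemma emeasure_cball: "emeasure lborel (cball (z::'a) r) = ennreal V"
proof -
  have "emeasure lborel (cball z r) = (\<integral>\<^sup>+x. indicator (cball z r) x \<partial>lborel)" by simp
  also have "\<dots> = (\<integral>\<^sup>+x. indicator (cball z r) (z + 1 *\<^sub>R x) \<partial>lborel)"
    using nn_integral_lborel_affine[of "indicator (cball z r)" 1 z] by simp
  also have "\<dots> = (\<integral>\<^sup>+x. indicator (cball (0::'a) r) x \<partial>lborel)"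
    by (intro nn_integral_cong) (auto simp: dist_norm split: split_indicator)
  also have "\<dots> = emeasure lborel (cball (0::'a) r)" by simp
  finally show ?thesis
    using emeasure_lborel_cball_finite[of "0::'a" r] by (simp add: V_def emeasure_eq_ennreal_measure)
qed

lemma measure_cball: "measure lborel (cball (z::'a) r) = V"
  using V_pos by (simp add: measure_def emeasure_cball)

lemma g_nonneg: "0 \<le> g x"
  using V_pos by (simp add: g_def)

text \<open>The condition \<open>dist z x \<le> r\<close> is symmetric and jointly measurable, which
  gives measurability of \<open>g\<close> and prepares for Fubini.\<close>

lemma ennreal_g: "ennreal V * ennreal (g x) = (\<integral>\<^sup>+z. (if dist z x \<le> r then 1 else 0) \<partial>\<mu>)"
proof -
  have "ennreal V * ennreal (g x) = emeasure \<mu> (cball x r)"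
    using V_pos by (simp add: g_def emeasure_eq_measure flip: ennreal_mult')
  also have "\<dots> = (\<integral>\<^sup>+z. indicator (cball x r) z \<partial>\<mu>)" by simp
  also have "\<dots> = (\<integral>\<^sup>+z. (if dist z x \<le> r then 1 else 0) \<partial>\<mu>)"
    by (intro nn_integral_cong) (auto simp: dist_commute split: split_indicator)
  finally show ?thesis .
qed

lemma g_measurable [measurable]: "g \<in> borel_measurable borel"
proof -
  have "g = (\<lambda>x. enn2real (\<integral>\<^sup>+z. (if dist z x \<le> r then 1 else 0) \<partial>\<mu>) / V)"
    using V_pos by (auto simp: fun_eq_iff enn2real_mult g_nonneg simp flip: ennreal_g)
  also have "\<dots> \<in> borel_measurable borel" by measurable
  finally show ?thesis .
qed

text \<open>By Fubini, integrating against \<open>g\<close> means averaging over a ball around a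
  \<mu>-random centre. The cases of a constant, an exponential and an indicator yield total mass,
  Laplace transform and measure of a set.\<close>

lemma nn_integral_g:
  assumes [measurable]: "h \<in> borel_measurable borel"
  shows "ennreal V * (\<integral>\<^sup>+x. ennreal (g x) * h x \<partial>lborel)
    = (\<integral>\<^sup>+z. (\<integral>\<^sup>+x. h x * indicator (cball z r) x \<partial>lborel) \<partial>\<mu>)"
proof -
  have "ennreal V * (\<integral>\<^sup>+x. ennreal (g x) * h x \<partial>lborel)
      = (\<integral>\<^sup>+x. (\<integral>\<^sup>+z. (if dist z x \<le> r then 1 else 0) \<partial>\<mu>) * h x \<partial>lborel)"
    by (subst nn_integral_cmult[symmetric]) (auto simp: mult.assoc simp flip: ennreal_g)
  also have "\<dots> = (\<integral>\<^sup>+x. (\<integral>\<^sup>+z. (if dist z x \<le> r then 1 else 0) * h x \<partial>\<mu>) \<partial>lborel)"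
    by (intro nn_integral_cong nn_integral_multc[symmetric]) auto
  also have "\<dots> = (\<integral>\<^sup>+z. (\<integral>\<^sup>+x. (if dist z x \<le> r then 1 else 0) * h x \<partial>lborel) \<partial>\<mu>)"
    by (rule P.Fubini') measurable
  also have "\<dots> = (\<integral>\<^sup>+z. (\<integral>\<^sup>+x. h x * indicator (cball z r) x \<partial>lborel) \<partial>\<mu>)"
    by (intro nn_integral_cong) (auto split: split_indicator)
  finally show ?thesis .
qed

text \<open>On the ball, \<open>v \<bullet> x\<close> splits into the constant
  \<open>v \<bullet> z\<close> and a part that is odd about \<open>z\<close>.\<close>

lemma integral_cball_inner:
  "has_bochner_integral lborel (\<lambda>x. indicator (cball z r) x * (v \<bullet> x)) (V * (v \<bullet> (z::'a)))"
proof -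
  have int: "integrable lborel (\<lambda>x. indicator (cball z r) x * h x)" if "continuous_on UNIV h" for h :: "'a \<Rightarrow> real"
    using borel_integrable_compact[of "cball z r" h] that
    by (auto intro: continuous_on_subset)
  define h where "h x = indicator (cball z r) x * (v \<bullet> (x - z))" for x
  have [measurable]: "h \<in> borel_measurable borel" unfolding h_def by measurable
  \<comment> \<open>reflection about \<open>z\<close>\<close>
  have "h (2 *\<^sub>R z + (-1) *\<^sub>R x) = - h x" for x
  proof -
    have "dist z (2 *\<^sub>R z - x) = dist z x"
      by (simp add: dist_norm norm_minus_commute scaleR_2)
    then show ?thesis
      by (auto simp: h_def scaleR_2 inner_diff_right inner_add_right split: split_indicator)
  qed
  then have h0: "(\<integral>x. h x \<partial>lborel) = 0"
    using integral_lborel_affine[of h "-1" "2 *\<^sub>R z"] by simp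
  have hI: "has_bochner_integral lborel h 0"
    unfolding has_bochner_integral_iff h0 h_def by (auto intro!: int continuous_intros)
  have "has_bochner_integral lborel (\<lambda>x. h x + (v \<bullet> z) * indicator (cball z r) x) (0 + (v \<bullet> z) * V)"
    using has_bochner_integral_real_indicator[of "cball z r" lborel] emeasure_cball[of z]
    by (intro has_bochner_integral_add hI has_bochner_integral_mult_right) (simp add: measure_cball)
  then show ?thesis
    by (rule has_bochner_integral_cong[THEN iffD1, rotated -1])
       (auto simp: h_def algebra_simps inner_diff_right)
qed

lemma integrable_inner: "integrable \<mu> (\<lambda>z. v \<bullet> z)" "(\<integral>z. v \<bullet> z \<partial>\<mu>) = 0"
  using centered by (auto simp: centered_def)

text \<open>Integrate \<open>h z x\<close> in both orders. Over \<open>z\<close> first it gives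
  \<open>V * (g x * (v \<bullet> x))\<close>; over \<open>x\<close> first it gives
  \<open>V * (v \<bullet> z)\<close>, whose \<mu>-integral is 0. Fubini applies because
  \<open>h_bound\<close> is integrable: balls have finite volume and \<mu> has a first
  moment.\<close>

lemma g_barycenter: "has_bochner_integral lborel (\<lambda>x. g x * (v \<bullet> x)) 0"
proof -
  define h where "h z x = (if dist z x \<le> r then v \<bullet> x else 0)" for z x :: 'a
  have h_ind: "h z x = indicator (cball z r) x * (v \<bullet> x)" for z x
    by (auto simp: h_def)
  have [measurable]: "case_prod h \<in> borel_measurable (\<mu> \<Otimes>\<^sub>M lborel)"
    unfolding h_def by measurable
  have h_bound: "norm (h z x) \<le> norm v * (norm z + r) * indicator (cball z r) x" for z x
  proof (cases "dist z x \<le> r")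
    case True
    have "norm x \<le> norm z + dist z x" by (metis dist_norm norm_triangle_sub norm_minus_commute)
    then have "norm v * norm x \<le> norm v * (norm z + r)" using True by (intro mult_left_mono) auto
    moreover have "\<bar>v \<bullet> x\<bar> \<le> norm v * norm x" by (rule Cauchy_Schwarz_ineq2)
    ultimately show ?thesis using True by (simp add: h_def)
  qed (simp add: h_def)
  have h_int: "integrable lborel (h z)" for z
    using integral_cball_inner[of z v] by (simp add: has_bochner_integral_iff h_ind[abs_def])
  have inner: "(\<integral>x. norm (h z x) \<partial>lborel) \<le> norm v * (norm z + r) * V" for z
  proof -
    have "(\<integral>x. norm (h z x) \<partial>lborel) \<le> (\<integral>x. norm v * (norm z + r) * indicator (cball z r) x \<partial>lborel)"
      using emeasure_cball[of z]
      by (intro integral_mono h_bound integrable_norm h_int integrable_mult_right integrable_real_indicator) auto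
    then show ?thesis by (simp add: measure_cball)
  qed
  have int: "integrable (\<mu> \<Otimes>\<^sub>M lborel) (case_prod h)"
  proof (rule P.Fubini_integrable)
    show "integrable \<mu> (\<lambda>z. \<integral>x. norm (case_prod h (z, x)) \<partial>lborel)"
    proof (rule Bochner_Integration.integrable_bound)
      show "integrable \<mu> (\<lambda>z. norm v * (norm z + r) * V)"
        using centered by (intro integrable_mult_left integrable_mult_right Bochner_Integration.integrable_add integrable_norm)
          (auto simp: centered_def)
      show "AE z in \<mu>. norm (\<integral>x. norm (case_prod h (z, x)) \<partial>lborel) \<le> norm (norm v * (norm z + r) * V)"
      proof (rule AE_I2)
        fix z
        have "0 \<le> (\<integral>x. norm (h z x) \<partial>lborel)" by (rule integral_nonneg_AE) simp
        with inner[of z] have "\<bar>\<integral>x. norm (h z x) \<partial>lborel\<bar> \<le> \<bar>norm v * (norm z + r) * V\<bar>"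
          by linarith
        then show "norm (\<integral>x. norm (case_prod h (z, x)) \<partial>lborel) \<le> norm (norm v * (norm z + r) * V)"
          by simp
      qed
    qed measurable
  qed (use h_int in auto)
  have inner_z: "(\<integral>z. h z x \<partial>\<mu>) = V * (g x * (v \<bullet> x))" for x
  proof -
    have "(\<integral>z. h z x \<partial>\<mu>) = (\<integral>z. indicator (cball x r) z * (v \<bullet> x) \<partial>\<mu>)"
      by (intro Bochner_Integration.integral_cong) (auto simp: h_def dist_commute split: split_indicator)
    also have "\<dots> = measure \<mu> (cball x r) * (v \<bullet> x)" by simp
    finally show ?thesis using V_pos by (simp add: g_def)
  qed
  have "integrable lborel (\<lambda>x. V * (g x * (v \<bullet> x)))"
    using P.integrable_snd[OF int] by (simp add: inner_z)
  moreover have "(\<integral>x. V * (g x * (v \<bullet> x)) \<partial>lborel) = 0"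
  proof -
    have "(\<integral>x. V * (g x * (v \<bullet> x)) \<partial>lborel) = (\<integral>z. (\<integral>x. h z x \<partial>lborel) \<partial>\<mu>)"
      using P.Fubini_integral[OF int] by (simp add: inner_z)
    also have "\<dots> = (\<integral>z. V * (v \<bullet> z) \<partial>\<mu>)"
      using integral_cball_inner[of _ v] by (intro Bochner_Integration.integral_cong) (auto simp: h_ind has_bochner_integral_iff)
    finally show ?thesis by (simp add: integrable_inner)
  qed
  ultimately have "has_bochner_integral lborel (\<lambda>x. (1 / V) * (V * (g x * (v \<bullet> x)))) ((1 / V) * 0)"
    by (intro has_bochner_integral_mult_right) (simp only: has_bochner_integral_iff)
  then show ?thesis using V_pos by simp
qed

text \<open>A convex combination of two balls of radius \<open>r\<close> lies in the ball of radius
  \<open>r\<close> about the combined centre, so log-concavity of \<mu> for these compact sets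
  suffices.\<close>

lemma g_log_concave:
  assumes l: "0 < l" "l < 1"
  shows "g x powr l * g y powr (1 - l) \<le> g (l *\<^sub>R x + (1 - l) *\<^sub>R y)"
proof -
  let ?S = "{l *\<^sub>R a + (1 - l) *\<^sub>R b | a b. a \<in> cball x r \<and> b \<in> cball y r}"
  have sub: "?S \<subseteq> cball (l *\<^sub>R x + (1 - l) *\<^sub>R y) r"
  proof clarify
    fix a b assume ab: "a \<in> cball x r" "b \<in> cball y r"
    have "norm (l *\<^sub>R (x - a) + (1 - l) *\<^sub>R (y - b)) \<le> l * norm (x - a) + (1 - l) * norm (y - b)"
      using norm_triangle_ineq[of "l *\<^sub>R (x - a)" "(1 - l) *\<^sub>R (y - b)"] l by simp
    also have "\<dots> \<le> l * r + (1 - l) * r"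
      using ab l by (intro add_mono mult_left_mono) (auto simp: dist_norm)
    finally show "l *\<^sub>R a + (1 - l) *\<^sub>R b \<in> cball (l *\<^sub>R x + (1 - l) *\<^sub>R y) r"
      by (simp add: dist_norm algebra_simps)
  qed
  have "measure \<mu> (cball x r) powr l * measure \<mu> (cball y r) powr (1 - l) \<le> measure \<mu> ?S"
    using log_concave l compact_cball[of x r] compact_cball[of y r]
    unfolding log_concave_prob_def by blast
  also have "\<dots> \<le> measure \<mu> (cball (l *\<^sub>R x + (1 - l) *\<^sub>R y) r)"
    using sub by (intro finite_measure_mono) auto
  finally have "measure \<mu> (cball x r) powr l * measure \<mu> (cball y r) powr (1 - l) / V
      \<le> measure \<mu> (cball (l *\<^sub>R x + (1 - l) *\<^sub>R y) r) / V"
    using V_pos by (simp add: divide_right_mono)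
  moreover have "V powr l * V powr (1 - l) = V"
    using V_pos by (simp flip: powr_add)
  ultimately show ?thesis
    using V_pos by (simp add: g_def powr_divide)
qed

lemma nn_integral_g_1: "(\<integral>\<^sup>+x. ennreal (g x) \<partial>lborel) = 1"
proof -
  have "ennreal V * (\<integral>\<^sup>+x. ennreal (g x) \<partial>lborel) = ennreal V * 1"
    using nn_integral_g[of "\<lambda>_. 1"] by (simp add: emeasure_cball emeasure_space_1[simplified])
  then show ?thesis using V_pos by (subst (asm) ennreal_mult_cancel_left) auto
qed

sublocale D: log_concave_density g
proof
  show "bdd_above (range g)"
    \<comment> \<open>The numerator of \<open>g\<close> is a probability.\<close>
    by (rule bdd_aboveI2[of _ _ "1 / V"]) (use V_pos in \<open>simp add: g_def divide_right_mono\<close>)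
qed (use g_nonneg g_log_concave nn_integral_g_1 g_barycenter in auto)

section \<open>Comparison of the measure with its smoothing\<close>

lemma laplace_smoothed_le: "laplace D.\<nu> \<xi> \<le> ennreal (exp (r * norm \<xi>)) * laplace \<mu> \<xi>"
proof -
  have "ennreal V * laplace D.\<nu> \<xi> = (\<integral>\<^sup>+z. (\<integral>\<^sup>+x. ennreal (exp (\<xi> \<bullet> x)) * indicator (cball z r) x \<partial>lborel) \<partial>\<mu>)"
    using nn_integral_g[of "\<lambda>x. ennreal (exp (\<xi> \<bullet> x))"]
    by (simp add: D.laplace_\<nu> ennreal_mult g_nonneg mult.commute)
  also have "\<dots> \<le> (\<integral>\<^sup>+z. (\<integral>\<^sup>+x. ennreal (exp (r * norm \<xi>)) * ennreal (exp (\<xi> \<bullet> z)) * indicator (cball z r) x \<partial>lborel) \<partial>\<mu>)"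
  proof (intro nn_integral_mono)
    fix x z
    show "ennreal (exp (\<xi> \<bullet> x)) * indicator (cball z r) x
        \<le> ennreal (exp (r * norm \<xi>)) * ennreal (exp (\<xi> \<bullet> z)) * indicator (cball z r) x"
    proof (cases "x \<in> cball z r")
      case True
      \<comment> \<open>A displacement of length at most \<open>r\<close> changes the exponent by at
        most \<open>r * norm \<xi>\<close>.\<close>
      have "\<xi> \<bullet> (x - z) \<le> norm \<xi> * norm (x - z)" by (rule norm_cauchy_schwarz)
      also have "\<dots> \<le> norm \<xi> * r" using True by (intro mult_left_mono) (auto simp: dist_norm norm_minus_commute)
      finally have "exp (\<xi> \<bullet> x) \<le> exp (r * norm \<xi>) * exp (\<xi> \<bullet> z)"
        by (simp add: inner_diff_right mult.commute flip: exp_add)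
      then show ?thesis using True by (simp add: ennreal_leI flip: ennreal_mult)
    qed simp
  qed
  also have "\<dots> = (\<integral>\<^sup>+z. ennreal (exp (r * norm \<xi>)) * ennreal V * ennreal (exp (\<xi> \<bullet> z)) \<partial>\<mu>)"
    by (intro nn_integral_cong, subst nn_integral_cmult_indicator) (simp_all add: emeasure_cball mult_ac)
  also have "\<dots> = ennreal V * (ennreal (exp (r * norm \<xi>)) * laplace \<mu> \<xi>)"
    unfolding laplace_def by (subst nn_integral_cmult) (auto simp: mult_ac)
  finally show ?thesis using V_pos by (subst (asm) ennreal_mult_le_mult_iff) auto
qed

text \<open>Smoothing moves mass by at most \<open>r\<close>, so the mass of \<open>S\<close> stays
  inside \<open>T\<close>.\<close>

lemma measure_le_smoothed:
  assumes [measurable]: "S \<in> sets borel" "T \<in> sets borel" and sub: "\<And>z. z \<in> S \<Longrightarrow> cball z r \<subseteq> T"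
  shows "measure \<mu> S \<le> measure D.\<nu> T"
proof -
  interpret N: prob_space D.\<nu> by (rule D.prob_space_\<nu>)
  have "ennreal V * emeasure \<mu> S = (\<integral>\<^sup>+z. ennreal V * indicator S z \<partial>\<mu>)"
    by (simp add: nn_integral_cmult)
  also have "\<dots> \<le> (\<integral>\<^sup>+z. (\<integral>\<^sup>+x. indicator T x * indicator (cball z r) x \<partial>lborel) \<partial>\<mu>)"
  proof (intro nn_integral_mono)
    fix z
    show "ennreal V * indicator S z \<le> (\<integral>\<^sup>+x. indicator T x * indicator (cball z r) x \<partial>lborel)"
    proof (cases "z \<in> S")
      case True
      have "ennreal V = (\<integral>\<^sup>+x. indicator (cball z r) x \<partial>lborel)" by (simp add: emeasure_cball)
      also have "\<dots> \<le> (\<integral>\<^sup>+x. indicator T x * indicator (cball z r) x \<partial>lborel)"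
        using sub[OF True] by (intro nn_integral_mono) (auto split: split_indicator)
      finally show ?thesis using True by simp
    qed simp
  qed
  also have "\<dots> = ennreal V * (\<integral>\<^sup>+x. ennreal (g x) * indicator T x \<partial>lborel)"
    by (rule nn_integral_g[symmetric]) simp
  also have "(\<integral>\<^sup>+x. ennreal (g x) * indicator T x \<partial>lborel) = emeasure D.\<nu> T"
    unfolding D.\<nu>_def by (subst emeasure_density) auto
  finally have "emeasure \<mu> S \<le> emeasure D.\<nu> T"
    using V_pos by (subst (asm) ennreal_mult_le_mult_iff) auto
  then show ?thesis by (simp add: emeasure_eq_measure N.emeasure_eq_measure)
qed

end

text \<open>The estimate for densities is transferred to \<mu>. The tail is exhausted by sets
  \<open>S k\<close> with bounded slopes, each compared with a smoothed tail at level
  \<open>s - \<epsilon>\<close>; then \<open>k\<close> tends to infinity and afterwards \<epsilon>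
  to 0.\<close>

lemma measure_tail_le:
  fixes \<mu> :: "'a::euclidean_space measure"
  assumes \<mu>: "log_concave_prob \<mu>" "centered \<mu>" and s: "0 < s"
  shows "measure \<mu> (tail \<mu> s) \<le> 3 * DIM('a) * exp (- s / (2 * DIM('a))) + 2 ^ DIM('a) * exp (- s / 4)"
proof -
  interpret prob_space \<mu> using \<mu> by (simp add: log_concave_prob_def)
  have [simp]: "sets \<mu> = sets borel" using \<mu> by (simp add: log_concave_prob_def)
  define B where "B s = 3 * DIM('a) * exp (- s / (2 * DIM('a))) + 2 ^ DIM('a) * exp (- s / 4)" for s :: real
  define S where "S k = (\<Union>\<xi>\<in>ball 0 (real (Suc k)). {x. laplace \<mu> \<xi> < ennreal (exp (\<xi> \<bullet> x - s))})" for k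
  have S_open: "open (S k)" for k
    unfolding S_def by (intro open_UN ballI open_laplace_less)
  have S_union: "(\<Union>k. S k) = tail \<mu> s"
  proof (intro equalityI subsetI)
    fix x assume "x \<in> tail \<mu> s"
    then obtain \<xi> where \<xi>: "laplace \<mu> \<xi> < ennreal (exp (\<xi> \<bullet> x - s))" by (auto simp: tail_def)
    obtain k where "norm \<xi> < real k" using reals_Archimedean2 by blast
    then have "\<xi> \<in> ball 0 (real (Suc k))" by simp
    with \<xi> show "x \<in> (\<Union>k. S k)" unfolding S_def by blast
  qed (auto simp: S_def tail_def)
  \<comment> \<open>On \<open>S k\<close> the slopes \<open>\<xi>\<close> are bounded, so smoothing at a small enough scale moves \<open>s\<close> by at most \<open>\<epsilon>\<close>.\<close>
  have S_bound: "measure \<mu> (S k) \<le> B (s - \<epsilon>)" if \<epsilon>: "0 < \<epsilon>" "\<epsilon> < s" for k \<epsilon>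
  proof -
    \<comment> \<open>One half of \<epsilon> pays for the growth of the Laplace transform under
      smoothing, the other for moving from \<open>z\<close> to \<open>x\<close>.\<close>
    define r where "r = \<epsilon> / (2 * real (Suc k))"
    have r: "0 < r" "2 * (r * real (Suc k)) = \<epsilon>" using \<epsilon> by (simp_all add: r_def del: of_nat_Suc)
    interpret R: smoothed_log_concave \<mu> r
      using \<mu> r by unfold_locales
    have "measure \<mu> (S k) \<le> measure R.D.\<nu> (tail R.D.\<nu> (s - \<epsilon>))"
    proof (rule R.measure_le_smoothed)
      fix z assume "z \<in> S k"
      then obtain \<xi> where n: "norm \<xi> < real (Suc k)" and lt: "laplace \<mu> \<xi> < ennreal (exp (\<xi> \<bullet> z - s))"
        by (auto simp: S_def)
      show "cball z r \<subseteq> tail R.D.\<nu> (s - \<epsilon>)"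
      proof
        fix x assume x: "x \<in> cball z r"
        have rn: "r * norm \<xi> \<le> r * real (Suc k)" using n r by (intro mult_left_mono) auto
        have "\<xi> \<bullet> (z - x) \<le> norm \<xi> * norm (z - x)" by (rule norm_cauchy_schwarz)
        also have "\<dots> \<le> norm \<xi> * r" using x by (intro mult_left_mono) (auto simp: dist_norm)
        finally have le: "\<xi> \<bullet> z + r * norm \<xi> \<le> \<xi> \<bullet> x + \<epsilon>"
          using rn r(2) by (simp only: inner_diff_right mult.commute[of r])
        have "laplace R.D.\<nu> \<xi> \<le> ennreal (exp (r * norm \<xi>)) * laplace \<mu> \<xi>"
          by (rule R.laplace_smoothed_le)
        also have "\<dots> < ennreal (exp (r * norm \<xi>)) * ennreal (exp (\<xi> \<bullet> z - s))"
          using lt by (intro ennreal_mult_strict_left_mono) auto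
        also have "\<dots> = ennreal (exp (r * norm \<xi> + (\<xi> \<bullet> z - s)))"
          by (simp add: exp_add ennreal_mult)
        also have "\<dots> \<le> ennreal (exp (\<xi> \<bullet> x - (s - \<epsilon>)))"
          using le by (intro ennreal_leI) simp
        finally show "x \<in> tail R.D.\<nu> (s - \<epsilon>)" by (auto simp: tail_def)
      qed
    qed (auto intro: borel_open S_open open_tail)
    also have "\<dots> \<le> B (s - \<epsilon>)"
      using R.D.measure_\<nu>_tail[of "s - \<epsilon>"] \<epsilon> by (simp add: B_def)
    finally show ?thesis .
  qed
  \<comment> \<open>\<open>S_bound\<close> is uniform in \<open>k\<close>, so continuity from below
    applies at fixed \<epsilon>.\<close>
  have "incseq S" by (force simp: incseq_def S_def)
  then have lim: "(\<lambda>k. measure \<mu> (S k)) \<longlonglongrightarrow> measure \<mu> (tail \<mu> s)"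
    unfolding S_union[symmetric]
    by (intro finite_Lim_measure_incseq) (auto intro: borel_open S_open)
  have le: "measure \<mu> (tail \<mu> s) \<le> B (s - \<epsilon>)" if "0 < \<epsilon>" "\<epsilon> < s" for \<epsilon>
    using LIMSEQ_le_const2[OF lim] S_bound[OF that] by blast
  have "((\<lambda>\<epsilon>. B (s - \<epsilon>)) \<longlongrightarrow> B (s - 0)) (at_right 0)"
    unfolding B_def by (intro tendsto_intros) auto
  moreover have "\<forall>\<^sub>F \<epsilon> in at_right 0. measure \<mu> (tail \<mu> s) \<le> B (s - \<epsilon>)"
    using eventually_at_right_real[OF s] by eventually_elim (use le in auto)
  ultimately have "measure \<mu> (tail \<mu> s) \<le> B (s - 0)"
    by (rule tendsto_lowerbound) simp
  then show ?thesis by (simp add: B_def)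
qed

subsection \<open>Integration of the tail bound\<close>

text \<open>Some slope in the supremum already exceeds \<open>s\<close>; exponentiate its
  inequality. An infinite Laplace transform would make the difference \<open>- \<infinity>\<close>,
  and for the value 0 the claim is immediate.\<close>

lemma less_cramer_transform_imp_tail:
  assumes "ereal s < cramer_transform \<mu> x"
  shows "x \<in> tail \<mu> s"
proof -
  from assms obtain \<xi> where \<xi>: "ereal s < ereal (x \<bullet> \<xi>) - ext_ln (laplace \<mu> \<xi>)"
    by (auto simp: cramer_transform_def legendre_def log_laplace_def laplace_def less_SUP_iff)
  have "laplace \<mu> \<xi> < ennreal (exp (\<xi> \<bullet> x - s))"
  proof (cases "laplace \<mu> \<xi>")
    case (real p)
    show ?thesis
    proof (cases "p = 0")
      case False
      with real have p: "0 < p" by simp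
      then have "s < x \<bullet> \<xi> - ln p" using \<xi> real by (simp add: ext_ln_def)
      then have "exp (ln p) < exp (\<xi> \<bullet> x - s)" by (simp add: inner_commute)
      then show ?thesis using p real by (simp add: ennreal_less_iff)
    qed (use real in simp)
  qed (use \<xi> in \<open>simp add: ext_ln_def\<close>)
  then show ?thesis by (auto simp: tail_def)
qed

lemma less_ext_exp_imp:
  assumes "0 < u" "0 < k" "ennreal u < ext_exp (c / ereal k)"
  shows "ereal (k * ln u) < c"
proof (rule ccontr)
  assume "\<not> ?thesis"
  then have c: "c \<le> ereal (k * ln u)" by simp
  have "ext_exp (c / ereal k) \<le> ennreal u"
  proof (cases c)
    case (real q)
    then have "q / k \<le> ln u" using c assms by (simp add: field_simps)
    then have "exp (q / k) \<le> u" using assms by (simp add: ln_ge_iff)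
    moreover have "c / ereal k = ereal (q / k)" using real assms by simp
    ultimately show ?thesis by (simp add: ext_exp_def ennreal_leI)
  qed (use c assms in \<open>auto simp: ext_exp_def\<close>)
  then show False using assms by simp
qed

text \<open>Joint openness in point and level provides the joint measurability for Fubini in the
  layer-cake argument.\<close>

lemma open_tail_graph: "open {(x, s). x \<in> tail \<mu> s}"
proof -
  have "open {p. laplace \<mu> \<xi> < ennreal (exp (\<xi> \<bullet> fst p - snd p))}" for \<xi>
  proof (cases "laplace \<mu> \<xi>")
    case (real r)
    have "{p. laplace \<mu> \<xi> < ennreal (exp (\<xi> \<bullet> fst p - snd p))} = {p. r < exp (\<xi> \<bullet> fst p - snd p)}"
      using real by (auto simp: ennreal_less_iff)
    then show ?thesis by (auto intro!: open_Collect_less continuous_intros)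
  qed simp
  moreover have "{(x, s). x \<in> tail \<mu> s} = (\<Union>\<xi>. {p. laplace \<mu> \<xi> < ennreal (exp (\<xi> \<bullet> fst p - snd p))})"
    by (auto simp: tail_def)
  ultimately show ?thesis by auto
qed

text \<open>Layer cake for a single value: \<open>A\<close> contains every real from
  \<open>a\<close> up to \<open>X\<close>, excluding \<open>X\<close>. Only an inclusion is asked
  for, so measurability is carried by the tail sets.\<close>

lemma le_add_emeasure:
  fixes X :: ennreal and a :: real
  assumes "0 \<le> a" and A: "A \<in> sets borel" and sub: "\<And>u. a \<le> u \<Longrightarrow> ennreal u < X \<Longrightarrow> u \<in> A"
  shows "X \<le> ennreal a + emeasure lborel A"
proof (rule dense_le)
  fix y assume y: "y < X"
  then obtain c where c: "y = ennreal c" "0 \<le> c" by (cases y) auto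
  show "y \<le> ennreal a + emeasure lborel A"
  proof (cases "c \<le> a")
    case True
    then show ?thesis using c by (simp add: add_increasing2 ennreal_leI)
  next
    case False
    have "{a..c} \<subseteq> A"
    proof
      fix u assume "u \<in> {a..c}"
      then have "a \<le> u" "ennreal u \<le> y" using c by (auto intro: ennreal_leI)
      then show "u \<in> A" using sub y by (meson le_less_trans)
    qed
    then have "emeasure lborel {a..c} \<le> emeasure lborel A"
      using A by (intro emeasure_mono) auto
    then have "ennreal a + ennreal (c - a) \<le> ennreal a + emeasure lborel A"
      using False by (intro add_left_mono) simp
    then show ?thesis using c False assms(1) by (simp flip: ennreal_plus)
  qed
qed

text \<open>With \<open>s = 16 * n * ln u\<close>, the two terms of the tail bound become multiples
  of \<open>u powr (- 8)\<close> and \<open>u powr (- (4 * n))\<close>; \<open>F\<close> is an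
  antiderivative vanishing at infinity.\<close>

lemma nn_integral_tail_bound:
  fixes n :: real
  assumes n: "1 \<le> n" and C: "0 \<le> C"
  shows "(\<integral>\<^sup>+u. ennreal (3 * n * u powr (- 8) + C * u powr (- (4 * n))) * indicator {3/2..} u \<partial>lborel)
    = ennreal (3 * n / 7 * (3/2) powr (- 7) + C / (4 * n - 1) * (3/2) powr (1 - 4 * n))"
proof -
  define F where "F u = - (3 * n / 7 * u powr (- 7)) - C / (4 * n - 1) * u powr (1 - 4 * n)" for u :: real
  have "(\<integral>\<^sup>+u. ennreal (3 * n * u powr (- 8) + C * u powr (- (4 * n))) * indicator {3/2..} u \<partial>lborel)
      = ennreal (0 - F (3/2))"
  proof (rule nn_integral_FTC_atLeast)
    fix u :: real assume u: "3/2 \<le> u"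
    show "(F has_real_derivative (3 * n * u powr (- 8) + C * u powr (- (4 * n)))) (at u)"
    proof -
      have "(F has_real_derivative - (3 * n / 7 * (- 7 * u powr (- 7 - 1)))
          - C / (4 * n - 1) * ((1 - 4 * n) * u powr (1 - 4 * n - 1))) (at u)"
        unfolding F_def using u
        by (intro DERIV_diff DERIV_minus DERIV_cmult has_real_derivative_powr) auto
      moreover have "C / (4 * n - 1) * (1 - 4 * n) = - C"
        using n by (simp add: divide_eq_eq) (simp add: algebra_simps)
      then have "C / (4 * n - 1) * ((1 - 4 * n) * p) = - C * p" for p
        by (simp only: mult.assoc[symmetric])
      ultimately show ?thesis by (simp add: mult.assoc)
    qed
    show "0 \<le> 3 * n * u powr (- 8) + C * u powr (- (4 * n))" using n C by simp
  next
    have "(F \<longlongrightarrow> - (3 * n / 7 * 0) - C / (4 * n - 1) * 0) at_top"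
      unfolding F_def using n by (intro tendsto_intros tendsto_neg_powr filterlim_ident) auto
    then show "(F \<longlongrightarrow> 0) at_top" by simp
  qed measurable
  then show ?thesis by (simp add: F_def add.commute)
qed

text \<open>The cutoff 3/2 is below 2 while its fourth power 81/16 exceeds 2, so the factor
  \<open>2 ^ n\<close> is absorbed into \<open>(32/81) ^ n\<close>.\<close>

lemma numeric_bound:
  fixes n :: nat
  assumes n: "1 \<le> n"
  shows "3/2 + (3 * real n / 7 * (3/2) powr (- 7) + 2 ^ n / (4 * real n - 1) * (3/2) powr (1 - 4 * real n))
    \<le> 2 * exp (real n * ln (real n) / 16)"
proof -
  have "2 ^ n * (3/2) powr (1 - 4 * real n) = 3/2 * (32/81) ^ n"
  proof -
    have "(3/2) powr (4 * real n) = ((3/2::real) ^ 4) ^ n"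
    proof -
      have "(3/2) powr (4 * real n) = (3/2) powr real (4 * n)" by simp
      also have "\<dots> = (3/2::real) ^ (4 * n)" by (rule powr_realpow) simp
      finally show ?thesis by (simp only: power_mult)
    qed
    then have "(3/2) powr (1 - 4 * real n) = 3/2 / (81/16) ^ n"
      by (simp add: powr_diff power_divide)
    then have "2 ^ n * (3/2) powr (1 - 4 * real n) = 3/2 * (2 ^ n / (81/16) ^ n)" by simp
    also have "2 ^ n / (81/16) ^ n = (32/81 :: real) ^ n" by (simp flip: power_divide)
    finally show ?thesis .
  qed
  also have "\<dots> \<le> 3/2 * (32/81)"
    using power_decreasing[of 1 n "32/81 :: real"] n by simp
  finally have "2 ^ n * (3/2) powr (1 - 4 * real n) / (4 * real n - 1) \<le> 3/2 * (32/81) / 3"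
    using n by (intro frac_le) auto
  moreover have "(3/2) powr (- 7) = (128/2187 :: real)"
    by (simp add: powr_minus_divide power_divide)
  ultimately have "3/2 + (3 * real n / 7 * (3/2) powr (- 7) + 2 ^ n / (4 * real n - 1) * (3/2) powr (1 - 4 * real n))
      \<le> 17/10 + real n * (26 / 1000)"
    using n by (simp only: times_divide_eq_left)
  also have "\<dots> \<le> 2 * exp (real n * ln (real n) / 16)"
  proof (cases "n = 1")
    case False
    with n have "2 \<le> real n" by simp
    \<comment> \<open>For \<open>n \<ge> 2\<close> the right-hand side is at least
      \<open>2 + n / 16\<close>, which dominates \<open>17/10 + n * (26/1000)\<close>; for
      \<open>n = 1\<close> it equals 2.\<close>
    have "1/2 \<le> ln (2::real)" using ln2_ge_two_thirds by simp
    also have "\<dots> \<le> ln (real n)" using \<open>2 \<le> real n\<close> by simp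
    finally have "real n * (1/2) \<le> real n * ln (real n)" by (intro mult_left_mono) auto
    moreover have "1 + real n * ln (real n) / 16 \<le> exp (real n * ln (real n) / 16)"
      by (rule exp_ge_add_one_self)
    ultimately show ?thesis by linarith
  qed simp
  finally show ?thesis .
qed

text \<open>The integrand exceeds \<open>u\<close> only on \<open>T u\<close>, so its integral is at
  most 3/2 plus the integral of the measure of \<open>T u\<close> over
  \<open>u \<ge> 3/2\<close>.\<close>

theorem nn_integral_exp_cramer_transform:
  fixes \<mu> :: "'a::euclidean_space measure"
  assumes \<mu>: "log_concave_prob \<mu>" "centered \<mu>"
  shows "(\<integral>\<^sup>+x. ext_exp (cramer_transform \<mu> x / ereal (16 * DIM('a))) \<partial>\<mu>)
    \<le> ennreal (2 * exp (DIM('a) * ln DIM('a) / 16))"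
proof -
  interpret prob_space \<mu> using \<mu> by (simp add: log_concave_prob_def)
  have sets [simp, measurable_cong]: "sets \<mu> = sets borel" using \<mu> by (simp add: log_concave_prob_def)
  have [simp]: "space \<mu> = UNIV" using sets_eq_imp_space_eq[OF sets] by simp
  interpret pair_sigma_finite \<mu> "lborel :: real measure" ..
  define n where "n = real DIM('a)"
  have n: "1 \<le> n" unfolding n_def using DIM_positive[where 'a='a] by linarith
  define T where "T u = tail \<mu> (16 * n * ln u)" for u
  \<comment> \<open>\<open>T\<close> is the preimage of the open graph under the measurable change
    of level from \<open>u\<close> to \<open>16 * n * ln u\<close>.\<close>
  have "{(x, s). x \<in> tail \<mu> s} \<in> sets (borel \<Otimes>\<^sub>M borel)"
    unfolding borel_prod by (rule borel_open[OF open_tail_graph])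
  then have "(\<lambda>(x, u). (x, 16 * n * ln u)) -` {(x, s). x \<in> tail \<mu> s} \<inter> space (\<mu> \<Otimes>\<^sub>M lborel) \<in> sets (\<mu> \<Otimes>\<^sub>M lborel)"
    by (rule measurable_sets[rotated]) measurable
  also have "(\<lambda>(x, u). (x, 16 * n * ln u)) -` {(x, s). x \<in> tail \<mu> s} \<inter> space (\<mu> \<Otimes>\<^sub>M lborel) = {p \<in> space (\<mu> \<Otimes>\<^sub>M lborel). fst p \<in> T (snd p)}"
    by (auto simp: T_def space_pair_measure)
  finally have T_sets [measurable]: "Measurable.pred (\<mu> \<Otimes>\<^sub>M lborel) (\<lambda>p. fst p \<in> T (snd p))"
    by (simp only: pred_def)
  define h where "h x u = (if x \<in> T u \<and> 3/2 \<le> u then 1 else 0 :: ennreal)" for x u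
  have [measurable]: "case_prod h \<in> borel_measurable (\<mu> \<Otimes>\<^sub>M lborel)"
    unfolding h_def case_prod_beta by measurable
  have pw: "ext_exp (cramer_transform \<mu> x / ereal (16 * n)) \<le> ennreal (3/2) + (\<integral>\<^sup>+u. h x u \<partial>lborel)" for x
  proof -
    have [measurable]: "h x \<in> borel_measurable borel"
      using measurable_Pair2[of "case_prod h" \<mu> lborel borel x] by simp
    have "{u. h x u = 1} \<in> sets borel" by measurable
    moreover have "{u. h x u = 1} = {u. x \<in> T u \<and> 3/2 \<le> u}" by (auto simp: h_def)
    ultimately have A: "{u. x \<in> T u \<and> 3/2 \<le> u} \<in> sets borel" by simp
    have "ext_exp (cramer_transform \<mu> x / ereal (16 * n)) \<le> ennreal (3/2) + emeasure lborel {u. x \<in> T u \<and> 3/2 \<le> u}"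
    proof (rule le_add_emeasure[OF _ A])
      fix u :: real assume u: "3/2 \<le> u" "ennreal u < ext_exp (cramer_transform \<mu> x / ereal (16 * n))"
      have "ereal (16 * n * ln u) < cramer_transform \<mu> x"
        by (rule less_ext_exp_imp) (use u n in auto)
      then show "u \<in> {u. x \<in> T u \<and> 3/2 \<le> u}"
        using u less_cramer_transform_imp_tail by (auto simp: T_def)
    qed simp
    also have "emeasure lborel {u. x \<in> T u \<and> 3/2 \<le> u} = (\<integral>\<^sup>+u. indicator {u. x \<in> T u \<and> 3/2 \<le> u} u \<partial>lborel)"
      using A by simp
    also have "\<dots> = (\<integral>\<^sup>+u. h x u \<partial>lborel)"
      by (intro nn_integral_cong) (auto simp: h_def)
    finally show ?thesis .
  qed
  have "(\<integral>\<^sup>+x. ext_exp (cramer_transform \<mu> x / ereal (16 * n)) \<partial>\<mu>)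
      \<le> (\<integral>\<^sup>+x. ennreal (3/2) + (\<integral>\<^sup>+u. h x u \<partial>lborel) \<partial>\<mu>)"
    by (intro nn_integral_mono pw)
  also have "\<dots> = ennreal (3/2) + (\<integral>\<^sup>+x. (\<integral>\<^sup>+u. h x u \<partial>lborel) \<partial>\<mu>)"
    by (subst nn_integral_add) (auto simp: emeasure_space_1[simplified])
  also have "(\<integral>\<^sup>+x. (\<integral>\<^sup>+u. h x u \<partial>lborel) \<partial>\<mu>) = (\<integral>\<^sup>+u. (\<integral>\<^sup>+x. h x u \<partial>\<mu>) \<partial>lborel)"
    by (rule Fubini'[symmetric]) measurable
  also have "\<dots> \<le> (\<integral>\<^sup>+u. ennreal (3 * n * u powr (- 8) + 2 ^ DIM('a) * u powr (- (4 * n))) * indicator {3/2..} u \<partial>lborel)"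
  proof (intro nn_integral_mono)
    fix u :: real
    show "(\<integral>\<^sup>+x. h x u \<partial>\<mu>) \<le> ennreal (3 * n * u powr (- 8) + 2 ^ DIM('a) * u powr (- (4 * n))) * indicator {3/2..} u"
    proof (cases "3/2 \<le> u")
      case True
      have "(\<integral>\<^sup>+x. h x u \<partial>\<mu>) = (\<integral>\<^sup>+x. indicator (T u) x \<partial>\<mu>)"
        using True by (intro nn_integral_cong) (auto simp: h_def)
      also have "\<dots> = ennreal (measure \<mu> (T u))"
        by (simp add: T_def borel_open open_tail emeasure_eq_measure)
      also have "\<dots> \<le> ennreal (3 * n * u powr (- 8) + 2 ^ DIM('a) * u powr (- (4 * n)))"
        \<comment> \<open>The level is positive because \<open>u \<ge> 3/2 > 1\<close>.\<close>
        using measure_tail_le[OF \<mu>, of "16 * n * ln u"] True n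
        by (intro ennreal_leI) (simp add: T_def n_def powr_def mult_ac)
      finally show ?thesis using True by simp
    qed (simp add: h_def)
  qed
  also have "\<dots> = ennreal (3 * n / 7 * (3/2) powr (- 7) + 2 ^ DIM('a) / (4 * n - 1) * (3/2) powr (1 - 4 * n))"
    by (rule nn_integral_tail_bound) (use n in auto)
  also have "ennreal (3/2) + \<dots> = ennreal (3/2 + (3 * n / 7 * (3/2) powr (- 7) + 2 ^ DIM('a) / (4 * n - 1) * (3/2) powr (1 - 4 * n)))"
    using n by (intro ennreal_plus[symmetric]) auto
  also have "\<dots> \<le> ennreal (2 * exp (n * ln n / 16))"
    unfolding n_def by (intro ennreal_leI numeric_bound) (simp add: Suc_leI)
  finally show ?thesis by (simp add: n_def add_left_mono)
qed

theorem mainTheorem6: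
  fixes \<mu> :: "(real ^ 'n) measure" and n :: nat
  assumes "n = CARD('n)"
    and "log_concave_prob \<mu>"
    and "centered \<mu>"
  shows "(\<integral>\<^sup>+x. ext_exp (cramer_transform \<mu> x / ereal (16 * real n)) \<partial>\<mu>)
           \<le> ennreal (2 * exp (real n * ln (real n) / 16))"
  using nn_integral_exp_cramer_transform[OF assms(2,3)] assms(1) by simp

end
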